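(* Let $G$ be a 3-regular graph with $n$ vertices. Then $\gamma_{plsR}(G)\geq \left\lceil\frac{3}{5}n\right\rceil$.
   Context: All graphs are finite, without loops or parallel edges. For a graph $G=(V,E)$ and $v\in V$, $N[v]=\{v\}\cup\{u : uv\in E\}$ is the closed neighborhood. A perfect locating signed Roman dominating (PLSRD) function on $G=(V,E)$ is a function $f: V\to\{-1,1,2\}$ such that: (C1) each vertex $v$ with $f(v)=-1$ is adjacent to exactly one vertex $u$ with $f(u)=2$; (C2) distinct vertices $v,w$ with $f(v)=f(w)=-1$ have no common neighbor $u$ with $f(u)=2$; (C3) for every vertex $v$, $\sum_{u\in N[v]} f(u)\geq 1$. The weight of $f$ is $f(V)=\sum_{v\in V} f(v)$. The perfect locating signed Roman domination number $\gamma_{plsR}(G)$ is the minimum weight over all PLSRD functions on $G$. *)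

theory Defs
  imports Complex_Main "HOL-Library.FuncSet" "Graph_Theory.Digraph"
begin

text \<open>
  Finite simple graphs are the locale \<^locale>\<open>graph\<close>: finite symmetric digraphs without loops
  and without parallel arcs. An undirected edge is a pair of opposite arcs, so the degree of a
  vertex is its out-degree.
\<close>

definition regular_graph :: "nat \<Rightarrow> ('a, 'b) pre_digraph \<Rightarrow> bool" where
  "regular_graph k G \<longleftrightarrow> graph G \<and> (\<forall>v \<in> verts G. out_degree G v = k)"

definition closed_nbhd :: "('a, 'b) pre_digraph \<Rightarrow> 'a \<Rightarrow> 'a set" where
  "closed_nbhd G v = {v} \<union> {u. v \<rightarrow>\<^bsub>G\<^esub> u}"

definition plsrd_function :: "('a, 'b) pre_digraph \<Rightarrow> ('a \<Rightarrow> int) \<Rightarrow> bool" where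
  "plsrd_function G f \<longleftrightarrow>
     f \<in> verts G \<rightarrow>\<^sub>E {-1, 1, 2} \<and>
     (\<forall>v \<in> verts G. f v = -1 \<longrightarrow> (\<exists>!u. v \<rightarrow>\<^bsub>G\<^esub> u \<and> f u = 2)) \<and>
     (\<forall>v \<in> verts G. \<forall>w \<in> verts G. v \<noteq> w \<and> f v = -1 \<and> f w = -1 \<longrightarrow>
        \<not> (\<exists>u. v \<rightarrow>\<^bsub>G\<^esub> u \<and> w \<rightarrow>\<^bsub>G\<^esub> u \<and> f u = 2)) \<and>
     (\<forall>v \<in> verts G. (\<Sum>u \<in> closed_nbhd G v. f u) \<ge> 1)"

definition weight :: "('a, 'b) pre_digraph \<Rightarrow> ('a \<Rightarrow> int) \<Rightarrow> int" where
  "weight G f = (\<Sum>v \<in> verts G. f v)"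

definition plsrd_number :: "('a, 'b) pre_digraph \<Rightarrow> int" where
  "plsrd_number G = Min {weight G f | f. plsrd_function G f}"

text \<open>
  The minimum is taken over a finite nonempty set (the constant function 1 qualifies),
  hence it is attained on every graph.
\<close>

lemma finite_plsrd_weights:
  assumes "graph G"
  shows "finite {weight G f | f. plsrd_function G f}"
proof -
  interpret graph G by fact
  have "finite (verts G \<rightarrow>\<^sub>E {-1, 1, 2 :: int})"
    by (rule finite_PiE) auto
  then have "finite {f. plsrd_function G f}"
    by (rule rev_finite_subset) (auto simp: plsrd_function_def)
  then show ?thesis
    by simp
qed

lemma plsrd_function_one:
  assumes "graph G"
  shows "plsrd_function G (\<lambda>v \<in> verts G. 1)"
proof -
  interpret graph G by fact
  have "(\<Sum>u \<in> closed_nbhd G v. (\<lambda>v \<in> verts G. 1 :: int) u) \<ge> 1" if v: "v \<in> verts G" for v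
  proof -
    have sub: "closed_nbhd G v \<subseteq> verts G"
      using v by (auto simp: closed_nbhd_def dest: adj_in_verts)
    then have fin: "finite (closed_nbhd G v)"
      by (rule finite_subset) simp
    have "(\<Sum>u \<in> closed_nbhd G v. (\<lambda>v \<in> verts G. 1 :: int) u) = (\<Sum>u \<in> closed_nbhd G v. 1)"
      using sub by (intro sum.cong) auto
    moreover have "card (closed_nbhd G v) > 0"
      using fin by (auto simp: card_gt_0_iff closed_nbhd_def)
    ultimately show ?thesis
      by simp
  qed
  then show ?thesis
    by (auto simp: plsrd_function_def)
qed

lemma plsrd_number_attained:
  assumes "graph G"
  shows "\<exists>f. plsrd_function G f \<and> weight G f = plsrd_number G"
proof -
  have "plsrd_number G \<in> {weight G f | f. plsrd_function G f}"
    unfolding plsrd_number_def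
    using finite_plsrd_weights[OF assms] plsrd_function_one[OF assms] by (intro Min_in) auto
  then show ?thesis
    by auto
qed

lemma plsrd_number_le:
  assumes "graph G" "plsrd_function G f"
  shows "plsrd_number G \<le> weight G f"
  unfolding plsrd_number_def
  using assms by (intro Min_le finite_plsrd_weights) auto

end

theory Submission
  imports Defs
begin

text \<open>
  Let \<open>M\<close>, \<open>P\<close>, \<open>T\<close> be the numbers of vertices with value -1, 1, 2. Sending a vertex of value -1 to
  its neighbour of value 2 is injective, so \<open>M \<le> T\<close>. By (C3) a vertex of value -1 has a neighbour of
  value 1, and a vertex of value 1 has at most two neighbours of value -1, so \<open>M \<le> 2 P\<close>. Hence the
  weight \<open>w = 2 T + P - M\<close> satisfies \<open>5 w - 3 (M + P + T) = 7 (T - M) + (2 P - M) \<ge> 0\<close>.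
\<close>

text \<open>The degree counts arcs, whereas (C3) sums over neighbours. Without parallel arcs,
  \<open>head G\<close> is injective on the arcs leaving \<open>v\<close>, so the two counts
  agree.\<close>

lemma (in graph) card_neighbours: "card {u. v \<rightarrow>\<^bsub>G\<^esub> u} = out_degree G v"
proof -
  have "{u. v \<rightarrow>\<^bsub>G\<^esub> u} = head G ` out_arcs G v"
    by (auto simp: arcs_ends_def arc_to_ends_def image_iff)
  moreover have "inj_on (head G) (out_arcs G v)"
    using no_multi_arcs by (auto simp: inj_on_def arc_to_ends_def)
  ultimately show ?thesis
    by (simp add: card_image out_degree_def)
qed

lemma (in graph) finite_neighbours: "finite {u. v \<rightarrow>\<^bsub>G\<^esub> u}"
  by (rule finite_subset[OF _ finite_verts]) auto

lemma (in graph) sum_closed_nbhd: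
  "(\<Sum>u \<in> closed_nbhd G v. f u) = f v + (\<Sum>u | v \<rightarrow>\<^bsub>G\<^esub> u. f u)"
proof -
  have "\<not> v \<rightarrow>\<^bsub>G\<^esub> v"
    using adj_not_same by blast
  then show ?thesis
    using finite_neighbours by (simp add: closed_nbhd_def)
qed

context
  fixes G :: "('a, 'b) pre_digraph" and f :: "'a \<Rightarrow> int"
  assumes reg: "regular_graph 3 G" and plsrd: "plsrd_function G f"
begin

interpretation graph G
  using reg by (simp add: regular_graph_def)

lemma plsrd_values: "v \<in> verts G \<Longrightarrow> f v = -1 \<or> f v = 1 \<or> f v = 2"
  using plsrd by (auto simp: plsrd_function_def)

lemma card_neighbours_3: "v \<in> verts G \<Longrightarrow> card {u. v \<rightarrow>\<^bsub>G\<^esub> u} = 3"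
  using reg by (simp add: card_neighbours regular_graph_def)

lemma plsrd_sum_ge: "v \<in> verts G \<Longrightarrow> f v + (\<Sum>u | v \<rightarrow>\<^bsub>G\<^esub> u. f u) \<ge> 1"
  using plsrd by (simp add: plsrd_function_def flip: sum_closed_nbhd)

text \<open>(C1) supplies the map \<open>g\<close> to a neighbour of value 2. If \<open>g\<close>
  identified two vertices of value -1, they would share that neighbour, against (C2).\<close>

lemma card_minus_one_le_card_two:
  "card {v \<in> verts G. f v = -1} \<le> card {v \<in> verts G. f v = 2}"
proof -
  have "\<forall>v \<in> {v \<in> verts G. f v = -1}. \<exists>u. v \<rightarrow>\<^bsub>G\<^esub> u \<and> f u = 2"
    using plsrd by (auto simp: plsrd_function_def)
  then obtain g where g: "\<And>v. v \<in> verts G \<Longrightarrow> f v = -1 \<Longrightarrow> v \<rightarrow>\<^bsub>G\<^esub> g v \<and> f (g v) = 2"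
    using bchoice[of "{v \<in> verts G. f v = -1}"] by auto metis
  have "inj_on g {v \<in> verts G. f v = -1}"
  proof (rule inj_onI, rule ccontr)
    fix v w
    assume v: "v \<in> {v \<in> verts G. f v = -1}" and w: "w \<in> {v \<in> verts G. f v = -1}"
      and eq: "g v = g w" and "v \<noteq> w"
    then have "\<not> (\<exists>u. v \<rightarrow>\<^bsub>G\<^esub> u \<and> w \<rightarrow>\<^bsub>G\<^esub> u \<and> f u = 2)"
      using plsrd unfolding plsrd_function_def by blast
    then show False
      using g[of v] g[of w] v w eq by auto
  qed
  then show ?thesis
    by (rule card_inj_on_le) (use g adj_in_verts(2) in auto)
qed

text \<open>By (C1) exactly one of the three neighbours has value 2. With no neighbour of value 1,
  the other two have value -1, and the closed neighbourhood sums to -1 + 2 - 1 - 1 = -1, against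
  (C3).\<close>

lemma minus_one_has_one_neighbour:
  assumes v: "v \<in> verts G" "f v = -1"
  shows "\<exists>u. v \<rightarrow>\<^bsub>G\<^esub> u \<and> f u = 1"
proof (rule ccontr)
  assume none: "\<nexists>u. v \<rightarrow>\<^bsub>G\<^esub> u \<and> f u = 1"
  let ?N = "{u. v \<rightarrow>\<^bsub>G\<^esub> u}"
  have "\<exists>!u. v \<rightarrow>\<^bsub>G\<^esub> u \<and> f u = 2"
    using plsrd v by (simp add: plsrd_function_def)
  then obtain u where u: "u \<in> ?N" "f u = 2" and uniq: "\<And>w. w \<in> ?N \<Longrightarrow> f w = 2 \<Longrightarrow> w = u"
    by auto
  have "f w = -1" if "w \<in> ?N - {u}" for w
    using that none uniq[of w] plsrd_values[of w] adj_in_verts(2)[of v w] by auto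
  then have "(\<Sum>w \<in> ?N - {u}. f w) = (\<Sum>w \<in> ?N - {u}. -1)"
    by (intro sum.cong) auto
  also have "\<dots> = -2"
    using u(1) card_neighbours_3[OF v(1)] finite_neighbours[of v] by (simp add: card_Diff_singleton)
  finally have "(\<Sum>w \<in> ?N. f w) = 0"
    using u finite_neighbours[of v] by (simp add: sum.remove[of ?N u])
  then show False
    using plsrd_sum_ge[OF v(1)] v(2) by simp
qed

text \<open>Three neighbours of value -1 would make the closed neighbourhood sum 1 - 3 = -2, against
  (C3).\<close>

lemma one_has_le_two_minus_one_neighbours:
  assumes p: "p \<in> verts G" "f p = 1"
  shows "card {v. p \<rightarrow>\<^bsub>G\<^esub> v \<and> f v = -1} \<le> 2"
proof (rule ccontr)
  let ?N = "{v. p \<rightarrow>\<^bsub>G\<^esub> v}" and ?A = "{v. p \<rightarrow>\<^bsub>G\<^esub> v \<and> f v = -1}"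
  assume "\<not> card ?A \<le> 2"
  moreover have "?A \<subseteq> ?N"
    by auto
  ultimately have "?A = ?N"
    \<comment> \<open>A subset with at least three elements exhausts the three-element set
      \<open>?N\<close>.\<close>
    using card_neighbours_3[OF p(1)] finite_neighbours[of p] by (intro card_seteq) auto
  then have "(\<Sum>v \<in> ?N. f v) = (\<Sum>v \<in> ?N. -1)"
    by (intro sum.cong) auto
  then show False
    using plsrd_sum_ge[OF p(1)] p(2) card_neighbours_3[OF p(1)] by simp
qed

text \<open>The sets \<open>?A p\<close>, for \<open>p\<close> of value 1, cover all vertices of
  value -1, and each has at most two elements; the union bound suffices, as the sets may
  overlap.\<close>

lemma card_minus_one_le_twice_card_one:
  "card {v \<in> verts G. f v = -1} \<le> 2 * card {v \<in> verts G. f v = 1}"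
proof -
  let ?P = "{v \<in> verts G. f v = 1}" and ?A = "\<lambda>p. {v. p \<rightarrow>\<^bsub>G\<^esub> v \<and> f v = -1}"
  have "{v \<in> verts G. f v = -1} \<subseteq> (\<Union>p \<in> ?P. ?A p)"
  proof
    fix v
    assume v: "v \<in> {v \<in> verts G. f v = -1}"
    then obtain u where u: "v \<rightarrow>\<^bsub>G\<^esub> u" "f u = 1"
      using minus_one_has_one_neighbour by auto
    then have "u \<rightarrow>\<^bsub>G\<^esub> v"
      using sym_arcs by (auto simp: symmetric_def dest: symD)
    then show "v \<in> (\<Union>p \<in> ?P. ?A p)"
      using u v adj_in_verts(2)[of v u] by auto
  qed
  moreover have "finite (\<Union>p \<in> ?P. ?A p)"
    by (rule finite_subset[OF _ finite_verts]) auto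
  ultimately have "card {v \<in> verts G. f v = -1} \<le> card (\<Union>p \<in> ?P. ?A p)"
    by (simp add: card_mono)
  also have "\<dots> \<le> (\<Sum>p \<in> ?P. card (?A p))"
    by (rule card_UN_le) simp
  also have "\<dots> \<le> (\<Sum>p \<in> ?P. 2)"
    by (rule sum_mono) (use one_has_le_two_minus_one_neighbours in auto)
  finally show ?thesis
    by simp
qed

text \<open>One formula serves two counts: the identity for \<open>h\<close> gives the weight, and
  the constant 1 gives the number of vertices.\<close>

lemma plsrd_sum_by_value:
  fixes h :: "int \<Rightarrow> int"
  shows "(\<Sum>v \<in> verts G. h (f v)) = h (-1) * card {v \<in> verts G. f v = -1}
    + h 1 * card {v \<in> verts G. f v = 1} + h 2 * card {v \<in> verts G. f v = 2}"
proof -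
  have "(\<Sum>v \<in> verts G. h (f v)) = (\<Sum>c \<in> {-1, 1, 2}. \<Sum>v | v \<in> verts G \<and> f v = c. h (f v))"
    by (rule sum.group[symmetric]) (use plsrd_values in auto)
  also have "\<dots> = (\<Sum>c \<in> {-1, 1, 2}. h c * card {v \<in> verts G. f v = c})"
    by (intro sum.cong) auto
  finally show ?thesis
    by simp
qed

lemma plsrd_weight_cubic_ge: "3 * int (card (verts G)) \<le> 5 * weight G f"
  using plsrd_sum_by_value[of "\<lambda>c. c"] plsrd_sum_by_value[of "\<lambda>c. 1"]
    card_minus_one_le_card_two card_minus_one_le_twice_card_one
  by (simp add: weight_def)

end

theorem theorem1:
  fixes G :: "('a, 'b) pre_digraph" and n :: nat
  assumes "regular_graph 3 G"
    and "card (verts G) = n"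
  shows "plsrd_number G \<ge> \<lceil>3 / 5 * real n\<rceil>"
proof -
  have "graph G"
    using assms(1) by (simp add: regular_graph_def)
  then obtain f where "plsrd_function G f" "weight G f = plsrd_number G"
    using plsrd_number_attained by blast
  then have "3 * int n \<le> 5 * plsrd_number G"
    using plsrd_weight_cubic_ge[OF assms(1)] assms(2) by metis
  \<comment> \<open>The ceiling comes for free because \<open>plsrd_number G\<close> is an
    integer.\<close>
  then show ?thesis
    by (simp add: ceiling_le_iff)
qed

end
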